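(* Let $n$ be a positive integer, let $[\alpha_1|\beta_1],[\alpha_2|\beta_2]\in S\text{-}Block(n)$, and let $k=\mathrm{len}(\alpha_1)$ and $j=\mathrm{len}(\alpha_2)$. Write $M=[\alpha_1|\beta_1]\wedge[\alpha_2|\beta_2]$ and $J=[\alpha_1|\beta_1]\vee[\alpha_2|\beta_2]$ for the meet and join in the lattice $S\text{-}Block(n)\cup\{\hat0,\hat1\}$. Then: (1) If $[\alpha_1|\beta_1],[\alpha_2|\beta_2]\in A(n,k)$, then $M\in A(n,k)$, and $J\in A(n,k)$ or $J=\hat1$. (2) If $[\alpha_1|\beta_1],[\alpha_2|\beta_2]\in A(n,k,k-1)$, then $M\in A(n,k,k-1)$, and $J\in A(n,k,k-1)$ or $J=\hat1$. (3a) If $k>j+1$, $[\alpha_1|\beta_1]\in A(n,k)$ and $[\alpha_2|\beta_2]\in A(n,j)$, then $M=\hat0$ and $J=\hat1$. (3b) If $k=j+1$, $[\alpha_1|\beta_1]\in A(n,k)$ and $[\alpha_2|\beta_2]\in A(n,k-1)$, then $M\in A(n,k,k-1)$ and $J=\hat1$. (4a) If $k>j+1$, $[\alpha_1|\beta_1]\in A(n,k,k-1)$ and $[\alpha_2|\beta_2]\in A(n,j,j-1)$, then $M=\hat0$ and $J=\hat1$. (4b) If $k=j+1$, $[\alpha_1|\beta_1]\in A(n,k,k-1)$ and $[\alpha_2|\beta_2]\in A(n,k-1,k-2)$, then $M=\hat0$, and $J\in A(n,k-1)$ or $J=\hat1$. (5) If $k\in\{j,j-1\}$, $[\alpha_1|\beta_1]\in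 A(n,k)$ and $[\alpha_2|\beta_2]\in A(n,j,j-1)$, then $M\in A(n,j,j-1)$, and $J\in A(n,k)$ or $J=\hat1$. (6) If $k\notin\{j,j-1\}$, $[\alpha_1|\beta_1]\in A(n,k)$ and $[\alpha_2|\beta_2]\in A(n,j,j-1)$, then $M=\hat0$ and $J=\hat1$. Moreover, in each case, $J=\hat1$ if and only if $(\beta_1\wedge\beta_2)\not\succeq(\alpha_1\vee\alpha_2)$.
   Context: $Dis(n)$ is the set of partitions $\gamma=(g_1,\dots,g_r)$ of $n$ into distinct positive parts $g_1>\dots>g_r>0$, with $\mathrm{len}(\gamma)=r$; $Dis_k(n)$ is the subset of those with exactly $k$ parts. For $\gamma=(g_1,\dots,g_r)$ and $\delta=(d_1,\dots,d_s)$ in $Dis(n)$, $\delta\succeq\gamma$ ($\delta$ majorizes $\gamma$) means $\sum_{i=1}^m d_i\ge\sum_{i=1}^m g_i$ for all $m\le\min\{r,s\}$. $Dis(n)$ is a lattice under this order; $\gamma\wedge\delta$, $\gamma\vee\delta$ for partitions denote meet and join in $Dis(n)$. An $S$-block is an ordered pair $[\alpha|\beta]$ with $\alpha,\beta\in Dis(n)$, $\beta\succeq\alpha$, and $\mathrm{len}(\alpha)\in\{\mathrm{len}(\beta),\mathrm{len}(\beta)+1\}$. $S\text{-}Block(n)$ is the poset of all such $S$-blocks, ordered by $[\alpha_1|\beta_1]\succeq[\alpha_2|\beta_2]$ iff $\alpha_1\succeq\alpha_2$ and $\beta_1\preceq\beta_2$. Adding a new minimum element $\hat0$ and a new maximum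 element $\hat1$ gives a lattice $S\text{-}Block(n)\cup\{\hat0,\hat1\}$. For $n\ge\binom{k+1}{2}$: $A(n,k)$ is the set of $S$-blocks $[\alpha|\beta]$ with $\alpha,\beta\in Dis_k(n)$; $A(n,k,k-1)$ is the set of $S$-blocks $[\alpha|\beta]$ with $\alpha\in Dis_k(n)$ and $\beta\in Dis_{k-1}(n)$. *)

theory Defs
  imports "HOL-Algebra.Lattice"
begin

definition Dis :: "nat \<Rightarrow> nat list set" where
  "Dis n = {\<gamma>. sorted_wrt (>) \<gamma> \<and> 0 \<notin> set \<gamma> \<and> sum_list \<gamma> = n}"

definition Dis_k :: "nat \<Rightarrow> nat \<Rightarrow> nat list set" where
  "Dis_k k n = {\<gamma> \<in> Dis n. length \<gamma> = k}"

definition majorizes :: "nat list \<Rightarrow> nat list \<Rightarrow> bool" (infix \<open>\<succeq>\<close> 50) where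
  "\<delta> \<succeq> \<gamma> \<longleftrightarrow>
    (\<forall>m \<le> min (length \<gamma>) (length \<delta>). sum_list (take m \<gamma>) \<le> sum_list (take m \<delta>))"

definition Dis_poset :: "nat \<Rightarrow> nat list gorder" where
  "Dis_poset n = \<lparr>carrier = Dis n, eq = (=), le = (\<lambda>\<gamma> \<delta>. \<delta> \<succeq> \<gamma>)\<rparr>"

text \<open>The $S$-block $[\alpha|\beta]$ is the pair \<open>(\<alpha>, \<beta>)\<close>.\<close>

type_synonym block = "nat list \<times> nat list"

definition S_Block :: "nat \<Rightarrow> block set" where
  "S_Block n = {(\<alpha>, \<beta>). \<alpha> \<in> Dis n \<and> \<beta> \<in> Dis n \<and> \<beta> \<succeq> \<alpha> \<and>
    (length \<alpha> = length \<beta> \<or> length \<alpha> = length \<beta> + 1)}"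

definition S_Block_poset :: "nat \<Rightarrow> block gorder" where
  "S_Block_poset n = \<lparr>carrier = S_Block n, eq = (=),
    le = (\<lambda>(\<alpha>\<^sub>2, \<beta>\<^sub>2) (\<alpha>\<^sub>1, \<beta>\<^sub>1). \<alpha>\<^sub>1 \<succeq> \<alpha>\<^sub>2 \<and> \<beta>\<^sub>2 \<succeq> \<beta>\<^sub>1)\<rparr>"

datatype 'a hat = Hat0 | Inner 'a | Hat1

fun hat_le :: "('a \<Rightarrow> 'a \<Rightarrow> bool) \<Rightarrow> 'a hat \<Rightarrow> 'a hat \<Rightarrow> bool" where
  "hat_le r Hat0 y = True"
| "hat_le r (Inner a) Hat0 = False"
| "hat_le r (Inner a) (Inner b) = r a b"
| "hat_le r (Inner a) Hat1 = True"
| "hat_le r Hat1 y = (y = Hat1)"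

definition add_hats :: "'a gorder \<Rightarrow> 'a hat gorder" where
  "add_hats L = \<lparr>carrier = {Hat0, Hat1} \<union> Inner ` carrier L, eq = (=), le = hat_le (le L)\<rparr>"

definition S_Block_hat :: "nat \<Rightarrow> block hat gorder" where
  "S_Block_hat n = add_hats (S_Block_poset n)"

definition A :: "nat \<Rightarrow> nat \<Rightarrow> block set" where
  "A n k = {(\<alpha>, \<beta>) \<in> S_Block n. \<alpha> \<in> Dis_k k n \<and> \<beta> \<in> Dis_k k n}"

text \<open>
  \<open>A' n k l\<close> is $A(n,k,l)$, used only with \<open>l = k - 1\<close> and \<open>k \<ge> 1\<close>. In both families
  the usual side condition $n \ge k(k+1)/2$ is not imposed, since the set is empty without it.
\<close>

definition A' :: "nat \<Rightarrow> nat \<Rightarrow> nat \<Rightarrow> block set" where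
  "A' n k l = {(\<alpha>, \<beta>) \<in> S_Block n. \<alpha> \<in> Dis_k k n \<and> \<beta> \<in> Dis_k l n}"

end

theory Submission
  imports Defs "HOL-Library.Nat_Bijection"
begin

text \<open>
  A partition into distinct parts is determined by its sequence of partial sums, which starts at
  \<open>0\<close>, is strictly concave until it reaches \<open>n\<close>, and then stays there. Conversely every such
  sequence comes from a partition (\<open>partition_of_concave\<close>). In this picture majorization
  is the pointwise order (\<open>majorizes_iff_psum\<close>), and the number of parts is the first
  index where the sequence equals \<open>n\<close>, so larger partitions have fewer parts
  (\<open>majorizes_length\<close>).

  The pointwise minimum of two such sequences is again of this kind, hence it is the meet, and its
  number of parts is the larger of the two (\<open>ex_meet\<close>). The join is the least of the common
  upper bounds. It cannot have more parts than either partition; nor can it have fewer than the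
  smaller number \<open>k\<close>, because it lies below the staircase-like partition
  \<open>(n - (1 + \<dots> + (k - 1)), k - 1, \<dots>, 1)\<close>, which majorizes every partition with at least
  \<open>k\<close> parts (\<open>ex_top_of_length\<close>). So the join has exactly \<open>k\<close> parts (\<open>ex_join\<close>).

  Blocks are ordered by the order on \<open>\<alpha>\<close> and the reversed order on \<open>\<beta>\<close>, so the candidates for
  meet and join of two blocks are \<open>(\<alpha>\<^sub>1 \<sqinter> \<alpha>\<^sub>2, \<beta>\<^sub>1 \<squnion> \<beta>\<^sub>2)\<close> and \<open>(\<alpha>\<^sub>1 \<squnion> \<alpha>\<^sub>2, \<beta>\<^sub>1 \<sqinter> \<beta>\<^sub>2)\<close>.
  The first always satisfies the majorization condition of a block and can only violate the
  length condition. The second always satisfies the length condition once it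
  satisfies the majorization condition. When a candidate is not a block, there is no
  bound within the blocks at all, and the adjoined element takes its place. All cases of the
  theorem then follow by comparing the numbers of parts, which are maxima and minima of the
  given ones.
\<close>

section \<open>Partitions as strictly concave sequences of partial sums\<close>

definition psum :: "nat list \<Rightarrow> nat \<Rightarrow> nat" where
  "psum \<gamma> m = sum_list (take m \<gamma>)"

lemma psum_0 [simp]: "psum \<gamma> 0 = 0"
  by (simp add: psum_def)

lemma psum_Suc: "m < length \<gamma> \<Longrightarrow> psum \<gamma> (Suc m) = psum \<gamma> m + \<gamma> ! m"
  by (simp add: psum_def take_Suc_conv_app_nth)

lemma psum_ge_length: "\<gamma> \<in> Dis n \<Longrightarrow> length \<gamma> \<le> m \<Longrightarrow> psum \<gamma> m = n"
  by (simp add: psum_def Dis_def)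

lemma Dis_nonempty: "\<gamma> \<in> Dis n \<Longrightarrow> 0 < n \<Longrightarrow> \<gamma> \<noteq> []"
  by (auto simp: Dis_def)

lemma length_le:
  assumes "\<gamma> \<in> Dis n"
  shows "length \<gamma> \<le> n"
proof -
  have "length \<gamma> \<le> sum_list \<gamma>" if "0 \<notin> set \<gamma>" for \<gamma> :: "nat list"
    using that by (induction \<gamma>) auto
  then show ?thesis using assms by (auto simp: Dis_def)
qed

lemma psum_strict_concave:
  assumes "\<gamma> \<in> Dis n" "m < length \<gamma>"
  shows "psum \<gamma> m + psum \<gamma> (Suc (Suc m)) < 2 * psum \<gamma> (Suc m)"
proof (cases "Suc m < length \<gamma>")
  case True
  have "\<gamma> ! m > \<gamma> ! Suc m"
    using assms True by (auto simp: Dis_def sorted_wrt_iff_nth_less)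
  then show ?thesis using True by (simp add: psum_Suc)
next
  case False
  have "\<gamma> ! m > 0"
    using assms by (metis (mono_tags, lifting) Dis_def mem_Collect_eq neq0_conv nth_mem)
  moreover have "psum \<gamma> (Suc (Suc m)) = psum \<gamma> (Suc m)"
    using assms False by (simp add: psum_ge_length)
  ultimately show ?thesis using assms by (simp add: psum_Suc)
qed

text \<open>
  The increments decrease and are eventually zero, so none of them is negative; going down from
  \<open>r\<close>, each is larger than its successor and therefore positive.
\<close>
lemma strictly_increasing_if_concave:
  fixes H :: "nat \<Rightarrow> nat"
  assumes const: "\<And>m. r \<le> m \<Longrightarrow> H m = n"
    and conc: "\<And>m. m < r \<Longrightarrow> H m + H (Suc (Suc m)) < 2 * H (Suc m)"
    and "m < r"
  shows "H m < H (Suc m)"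
proof -
  have "H m \<le> H (Suc m)" if "m \<le> r" for m
    using that
  proof (induction rule: inc_induct)
    case base
    show ?case using const[of r] const[of "Suc r"] by simp
  next
    case (step m)
    then show ?case using conc[of m] by linarith
  qed
  from this[of "Suc m"] conc[of m] \<open>m < r\<close> show ?thesis by linarith
qed

lemma psum_less:
  assumes \<gamma>: "\<gamma> \<in> Dis n" and m: "m < length \<gamma>"
  shows "psum \<gamma> m < n"
proof -
  have "psum \<gamma> m < psum \<gamma> (Suc m)"
    using strictly_increasing_if_concave[where H = "psum \<gamma>" and r = "length \<gamma>"]
      psum_ge_length[OF \<gamma>] psum_strict_concave[OF \<gamma>] m
    by blast
  also have "\<dots> \<le> psum \<gamma> (length \<gamma>)"
    using m unfolding psum_def
    by (metis append_take_drop_id le_add1 order_refl sum_list_append take_all)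
  finally show ?thesis using psum_ge_length[OF \<gamma>] by simp
qed

lemma psum_le: "\<gamma> \<in> Dis n \<Longrightarrow> psum \<gamma> m \<le> n"
  using psum_less[of \<gamma> n m] psum_ge_length[of \<gamma> n m] by (cases "m < length \<gamma>") auto

text \<open>
  The parts are the increments of \<open>H\<close>: strict concavity makes them distinct and decreasing, and
  they are positive because \<open>H\<close> increases. This is how partitions are constructed below.
\<close>
lemma partition_of_concave:
  assumes zero: "H 0 = 0"
    and const: "\<And>m. r \<le> m \<Longrightarrow> H m = n"
    and conc: "\<And>m. m < r \<Longrightarrow> H m + H (Suc (Suc m)) < 2 * H (Suc m)"
  obtains \<gamma> where "\<gamma> \<in> Dis n" "length \<gamma> = r" "psum \<gamma> = H"
proof
  define \<gamma> where "\<gamma> = map (\<lambda>m. H (Suc m) - H m) [0..<r]"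
  show len: "length \<gamma> = r" by (simp add: \<gamma>_def)
  have inc: "H m < H (Suc m)" if "m < r" for m
    using strictly_increasing_if_concave[where H = H] const conc that by blast
  have le_r: "psum \<gamma> m = H m" if "m \<le> r" for m
    using that
  proof (induction m)
    case (Suc m)
    then show ?case using inc[of m] by (simp add: psum_Suc len) (simp add: \<gamma>_def)
  qed (simp add: zero)
  have total: "sum_list \<gamma> = n"
    using le_r[of r] const[of r] len by (simp add: psum_def)
  show "psum \<gamma> = H"
  proof
    fix m show "psum \<gamma> m = H m"
      using le_r[of m] const[of m] total len by (cases "m \<le> r") (auto simp: psum_def)
  qed
  have "\<gamma> ! Suc m < \<gamma> ! m" if "Suc m < r" for m
    using conc[of m] inc[of m] inc[of "Suc m"] that by (simp add: \<gamma>_def)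
  then have "sorted_wrt (>) \<gamma>"
    by (subst sorted_wrt_iff_nth_Suc_transp) (auto simp: len)
  moreover have "0 \<notin> set \<gamma>"
    using inc by (fastforce simp: \<gamma>_def)
  ultimately show "\<gamma> \<in> Dis n" using total by (simp add: Dis_def)
qed

section \<open>Majorization\<close>

text \<open>
  The definition only compares partial sums up to the shorter length. Nothing is lost: if
  \<open>\<delta>\<close> had more parts than \<open>\<gamma>\<close>, then at \<open>m = length \<gamma>\<close> the sum of \<open>\<gamma>\<close> would be \<open>n\<close> and that of
  \<open>\<delta>\<close> still smaller; and beyond the length of \<open>\<delta>\<close> its sums are already maximal.
\<close>
lemma majorizes_iff_psum:
  assumes \<gamma>: "\<gamma> \<in> Dis n" and \<delta>: "\<delta> \<in> Dis n"
  shows "\<delta> \<succeq> \<gamma> \<longleftrightarrow> (\<forall>m. psum \<gamma> m \<le> psum \<delta> m)"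
proof
  assume maj: "\<delta> \<succeq> \<gamma>"
  have le: "psum \<gamma> m \<le> psum \<delta> m" if "m \<le> length \<gamma>" "m \<le> length \<delta>" for m
    using maj that by (simp add: majorizes_def psum_def)
  have len: "length \<delta> \<le> length \<gamma>"
    using le[of "length \<gamma>"] psum_less[OF \<delta>, of "length \<gamma>"] psum_ge_length[OF \<gamma>, of "length \<gamma>"]
    by force
  show "\<forall>m. psum \<gamma> m \<le> psum \<delta> m"
  proof
    fix m show "psum \<gamma> m \<le> psum \<delta> m"
      using le[of m] len psum_le[OF \<gamma>, of m] psum_ge_length[OF \<delta>, of m]
      by (cases "m \<le> length \<delta>") auto
  qed
qed (simp add: majorizes_def psum_def)

lemma majorizes_length:
  assumes "\<gamma> \<in> Dis n" "\<delta> \<in> Dis n" "\<delta> \<succeq> \<gamma>"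
  shows "length \<delta> \<le> length \<gamma>"
proof -
  have "psum \<gamma> (length \<gamma>) \<le> psum \<delta> (length \<gamma>)"
    using assms majorizes_iff_psum by blast
  then show ?thesis
    using psum_ge_length[OF assms(1) order.refl] psum_less[OF assms(2), of "length \<gamma>"] by linarith
qed

lemma majorizes_antisym:
  assumes \<gamma>: "\<gamma> \<in> Dis n" and \<delta>: "\<delta> \<in> Dis n" and "\<delta> \<succeq> \<gamma>" "\<gamma> \<succeq> \<delta>"
  shows "\<gamma> = \<delta>"
proof (rule nth_equalityI)
  have eq: "psum \<gamma> m = psum \<delta> m" for m
    using assms by (simp add: majorizes_iff_psum order.antisym)
  show len: "length \<gamma> = length \<delta>"
    using assms by (simp add: majorizes_length order.antisym)
  show "\<gamma> ! i = \<delta> ! i" if "i < length \<gamma>" for i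
    using psum_Suc[of i \<gamma>] psum_Suc[of i \<delta>] that len eq by simp
qed

lemma majorizes_refl: "\<gamma> \<succeq> \<gamma>"
  by (simp add: majorizes_def)

lemma majorizes_trans:
  assumes "\<alpha> \<in> Dis n" "\<beta> \<in> Dis n" "\<gamma> \<in> Dis n" "\<alpha> \<succeq> \<beta>" "\<beta> \<succeq> \<gamma>"
  shows "\<alpha> \<succeq> \<gamma>"
  using assms(4,5) unfolding majorizes_iff_psum[OF assms(2,1)] majorizes_iff_psum[OF assms(3,2)]
    majorizes_iff_psum[OF assms(3,1)] by (blast intro: order_trans)

section \<open>Meets and joins of partitions\<close>

text \<open>
  The minimum of two concave sequences is concave, but strictness needs an argument because each
  sequence is strictly concave only before it reaches \<open>n\<close>. Before the larger of the two lengths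
  one sequence \<open>\<epsilon>\<close> is still strictly concave, and if the other is not, it already equals \<open>n\<close>,
  so the minimum at \<open>Suc m\<close> is attained by \<open>\<epsilon>\<close>.
\<close>
lemma ex_meet:
  assumes \<gamma>: "\<gamma> \<in> Dis n" and \<delta>: "\<delta> \<in> Dis n"
  obtains \<mu> where "\<mu> \<in> Dis n" "length \<mu> = max (length \<gamma>) (length \<delta>)"
    "\<And>m. psum \<mu> m = min (psum \<gamma> m) (psum \<delta> m)"
proof -
  let ?H = "\<lambda>m. min (psum \<gamma> m) (psum \<delta> m)"
  let ?r = "max (length \<gamma>) (length \<delta>)"
  have conc: "?H m + ?H (Suc (Suc m)) < 2 * ?H (Suc m)" if m: "m < ?r" for m
  proof -
    have concave_at: "?H m + ?H (Suc (Suc m)) < 2 * psum \<epsilon> (Suc m)"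
      if "\<epsilon> \<in> {\<gamma>, \<delta>}" "m < length \<epsilon>" for \<epsilon>
      using psum_strict_concave[of \<epsilon> n m] that \<gamma> \<delta> by auto
    have past_end: "psum \<epsilon> (Suc m) = n" if "\<epsilon> \<in> {\<gamma>, \<delta>}" "\<not> m < length \<epsilon>" for \<epsilon>
      using that psum_ge_length[of \<epsilon> n "Suc m"] \<gamma> \<delta> by auto
    show ?thesis
      using concave_at[of \<gamma>] concave_at[of \<delta>] past_end[of \<gamma>] past_end[of \<delta>] m
        psum_le[OF \<gamma>, of "Suc m"] psum_le[OF \<delta>, of "Suc m"]
      by (cases "m < length \<gamma>"; cases "m < length \<delta>") (auto simp: min_def)
  qed
  obtain \<mu> where "\<mu> \<in> Dis n" "length \<mu> = ?r" "psum \<mu> = ?H"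
    using partition_of_concave[of ?H ?r n] conc psum_ge_length[OF \<gamma>] psum_ge_length[OF \<delta>]
    by auto
  then show ?thesis using that by simp
qed

lemma triangle_le_sum_list:
  assumes "sorted_wrt (>) xs" "0 \<notin> set xs"
  shows "triangle (length xs) \<le> sum_list xs"
proof -
  \<comment> \<open>The second conjunct makes the induction work: the head exceeds the number of parts after it.\<close>
  have "triangle (length xs) \<le> sum_list xs \<and> (\<forall>y. (\<forall>x\<in>set xs. x < y) \<longrightarrow> length xs \<le> y - 1)"
    using assms
  proof (induction xs)
    case (Cons a xs)
    then have IH: "triangle (length xs) \<le> sum_list xs" "length xs \<le> a - 1" "0 < a" by auto
    moreover have "a \<le> y - 1" if "a < y" for y using that by simp
    ultimately show ?case by fastforce
  qed simp
  then show ?thesis ..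
qed

text \<open>The parts after the first \<open>m\<close> are distinct and positive, so they sum to at least a triangular number.\<close>
lemma psum_add_triangle_le:
  assumes "\<gamma> \<in> Dis n"
  shows "psum \<gamma> m + triangle (length \<gamma> - m) \<le> n"
proof -
  have "triangle (length (drop m \<gamma>)) \<le> sum_list (drop m \<gamma>)"
    using assms by (intro triangle_le_sum_list sorted_wrt_drop) (auto simp: Dis_def dest: in_set_dropD)
  moreover have "psum \<gamma> m + sum_list (drop m \<gamma>) = n"
    using assms by (simp add: psum_def Dis_def flip: sum_list_append)
  ultimately show ?thesis by simp
qed

lemma triangle_mono: "a \<le> b \<Longrightarrow> triangle a \<le> triangle b"
  by (rule lift_Suc_mono_le) simp_all

text \<open>
  The witness is the staircase \<open>k - 1, \<dots>, 1\<close> preceded by all that remains of \<open>n\<close>. The sum of its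
  parts after the first \<open>m \<ge> 1\<close> is \<open>triangle (k - m)\<close>, the least possible for any partition with
  at least \<open>k\<close> parts, so its partial sums are the largest possible.
\<close>
lemma ex_top_of_length:
  assumes "0 < k" "triangle k \<le> n"
  obtains \<tau> where "\<tau> \<in> Dis n" "length \<tau> = k"
    "\<And>\<gamma>. \<gamma> \<in> Dis n \<Longrightarrow> k \<le> length \<gamma> \<Longrightarrow> \<tau> \<succeq> \<gamma>"
proof -
  let ?H = "\<lambda>m. if m = 0 then 0 else n - triangle (k - m)"
  have conc: "?H m + ?H (Suc (Suc m)) < 2 * ?H (Suc m)" if m: "m < k" for m
  proof -
    obtain a where k: "k = Suc (m + a)" using less_imp_Suc_add[OF m] by blast
    have "triangle (Suc a) \<le> triangle k" by (rule triangle_mono) (simp add: k)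
    then have n: "triangle (Suc a) \<le> n" using assms by linarith
    show ?thesis
      using n assms k by (cases a; cases m) (auto simp: Suc_diff_Suc)
  qed
  obtain \<tau> where \<tau>: "\<tau> \<in> Dis n" "length \<tau> = k" "psum \<tau> = ?H"
    using partition_of_concave[of ?H k n] conc assms by auto
  have "\<tau> \<succeq> \<gamma>" if \<gamma>: "\<gamma> \<in> Dis n" "k \<le> length \<gamma>" for \<gamma>
  proof -
    have "psum \<gamma> m \<le> psum \<tau> m" for m
      using psum_add_triangle_le[OF \<gamma>(1), of m] triangle_mono[of "k - m" "length \<gamma> - m"] \<gamma>(2)
      by (simp add: \<tau>(3) diff_le_mono) linarith
    then show ?thesis using majorizes_iff_psum \<tau>(1) \<gamma>(1) by blast
  qed
  then show ?thesis using that \<tau> by blast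
qed

text \<open>
  Upper bounds are closed under meets, so an upper bound with the smallest total of partial sums
  is below all others: its meet with another one is again an upper bound and cannot have a
  smaller total. The partition from \<open>ex_top_of_length\<close> serves twice, as an upper bound to start
  from and to show that the join does not lose parts.
\<close>
lemma ex_join:
  assumes "n > 0" and \<gamma>: "\<gamma> \<in> Dis n" and \<delta>: "\<delta> \<in> Dis n"
  obtains \<sigma> where "\<sigma> \<in> Dis n" "\<sigma> \<succeq> \<gamma>" "\<sigma> \<succeq> \<delta>" "length \<sigma> = min (length \<gamma>) (length \<delta>)"
    "\<And>\<upsilon>. \<upsilon> \<in> Dis n \<Longrightarrow> \<upsilon> \<succeq> \<gamma> \<Longrightarrow> \<upsilon> \<succeq> \<delta> \<Longrightarrow> \<upsilon> \<succeq> \<sigma>"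
proof -
  let ?k = "min (length \<gamma>) (length \<delta>)"
  let ?ub = "\<lambda>\<upsilon>. \<upsilon> \<in> Dis n \<and> \<upsilon> \<succeq> \<gamma> \<and> \<upsilon> \<succeq> \<delta>"
  \<comment> \<open>Summing up to \<open>n\<close> suffices, since a partition of \<open>n\<close> has at most \<open>n\<close> parts.\<close>
  let ?size = "\<lambda>\<upsilon>. \<Sum>m\<le>n. psum \<upsilon> m"
  have "0 < ?k" using \<gamma> \<delta> \<open>n > 0\<close> by (simp add: Dis_nonempty)
  moreover have "triangle ?k \<le> n"
    using psum_add_triangle_le[OF \<gamma>, of 0] psum_add_triangle_le[OF \<delta>, of 0] by (simp add: min_def)
  ultimately obtain \<tau> where \<tau>: "\<tau> \<in> Dis n" "length \<tau> = ?k"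
      and top: "\<And>\<gamma>. \<gamma> \<in> Dis n \<Longrightarrow> ?k \<le> length \<gamma> \<Longrightarrow> \<tau> \<succeq> \<gamma>"
    using ex_top_of_length by blast
  have ub_\<tau>: "?ub \<tau>" using \<tau> top \<gamma> \<delta> by auto
  obtain \<sigma> where \<sigma>: "?ub \<sigma>" and minimal: "\<And>\<upsilon>. ?ub \<upsilon> \<Longrightarrow> ?size \<sigma> \<le> ?size \<upsilon>"
    using ex_has_least_nat[of ?ub \<tau> ?size] ub_\<tau> by blast
  have least: "\<upsilon> \<succeq> \<sigma>" if \<upsilon>: "?ub \<upsilon>" for \<upsilon>
  proof -
    obtain \<mu> where \<mu>: "\<mu> \<in> Dis n" and psum_\<mu>: "\<And>m. psum \<mu> m = min (psum \<sigma> m) (psum \<upsilon> m)"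
      using ex_meet \<sigma> \<upsilon> by metis
    have "?ub \<mu>" using \<mu> \<sigma> \<upsilon> \<gamma> \<delta> by (auto simp: majorizes_iff_psum psum_\<mu>)
    then have size: "?size \<sigma> \<le> ?size \<mu>" by (rule minimal)
    have "psum \<sigma> m \<le> psum \<upsilon> m" for m
    proof (cases "m \<le> n")
      case True
      show ?thesis
      proof (rule ccontr)
        assume "\<not> ?thesis"
        then have "\<exists>m\<in>{..n}. psum \<mu> m < psum \<sigma> m"
          using True by (intro bexI[of _ m]) (auto simp: psum_\<mu>)
        then have "?size \<mu> < ?size \<sigma>"
          by (intro sum_strict_mono_ex1) (simp_all add: psum_\<mu>)
        with size show False by simp
      qed
    next
      case False
      then have "length \<upsilon> \<le> m" using \<upsilon> length_le[of \<upsilon> n] by linarith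
      then have "psum \<upsilon> m = n" using \<upsilon> psum_ge_length by blast
      then show ?thesis using \<sigma> psum_le[of \<sigma> n m] by simp
    qed
    then show ?thesis using majorizes_iff_psum \<sigma> \<upsilon> by blast
  qed
  have "length \<sigma> = ?k"
    using majorizes_length[of \<gamma> n \<sigma>] majorizes_length[of \<delta> n \<sigma>] \<sigma> \<gamma> \<delta>
      majorizes_length[of \<sigma> n \<tau>] least[OF ub_\<tau>] \<tau> by auto
  then show ?thesis using that \<sigma> least by blast
qed

lemma (in partial_order) meet_eqI:
  assumes "x \<in> carrier L" "y \<in> carrier L" "g \<in> carrier L" "g \<sqsubseteq> x" "g \<sqsubseteq> y"
    and "\<And>z. z \<in> carrier L \<Longrightarrow> z \<sqsubseteq> x \<Longrightarrow> z \<sqsubseteq> y \<Longrightarrow> z \<sqsubseteq> g"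
  shows "x \<sqinter> y = g"
proof -
  have "greatest L g (Lower L {x, y})"
    using assms by (auto simp: greatest_def Lower_def)
  then show ?thesis
    unfolding meet_def inf_def using greatest_unique by (metis someI)
qed

lemma (in partial_order) join_eqI:
  assumes "x \<in> carrier L" "y \<in> carrier L" "s \<in> carrier L" "x \<sqsubseteq> s" "y \<sqsubseteq> s"
    and "\<And>z. z \<in> carrier L \<Longrightarrow> x \<sqsubseteq> z \<Longrightarrow> y \<sqsubseteq> z \<Longrightarrow> s \<sqsubseteq> z"
  shows "x \<squnion> y = s"
proof -
  have "least L s (Upper L {x, y})"
    using assms by (auto simp: least_def Upper_def)
  then show ?thesis
    unfolding join_def sup_def using least_unique by (metis someI)
qed

lemma partial_order_Dis: "partial_order (Dis_poset n)"
  by unfold_locales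
    (auto simp: Dis_poset_def intro: majorizes_refl majorizes_antisym majorizes_trans)

lemma Dis_meet:
  assumes "\<gamma> \<in> Dis n" "\<delta> \<in> Dis n"
  defines "\<mu> \<equiv> \<gamma> \<sqinter>\<^bsub>Dis_poset n\<^esub> \<delta>"
  shows "\<mu> \<in> Dis n" "length \<mu> = max (length \<gamma>) (length \<delta>)"
    "\<And>\<epsilon>. \<epsilon> \<in> Dis n \<Longrightarrow> \<mu> \<succeq> \<epsilon> \<longleftrightarrow> \<gamma> \<succeq> \<epsilon> \<and> \<delta> \<succeq> \<epsilon>"
proof -
  obtain \<nu> where \<nu>: "\<nu> \<in> Dis n" "length \<nu> = max (length \<gamma>) (length \<delta>)"
    "\<And>m. psum \<nu> m = min (psum \<gamma> m) (psum \<delta> m)"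
    using ex_meet assms by metis
  have below: "\<nu> \<succeq> \<epsilon> \<longleftrightarrow> \<gamma> \<succeq> \<epsilon> \<and> \<delta> \<succeq> \<epsilon>" if "\<epsilon> \<in> Dis n" for \<epsilon>
    using that assms \<nu> by (auto simp: majorizes_iff_psum)
  have "\<mu> = \<nu>"
    unfolding \<mu>_def using below[OF \<nu>(1)] below \<nu>(1) assms majorizes_refl
    by (intro partial_order.meet_eqI[OF partial_order_Dis]) (auto simp: Dis_poset_def)
  then show "\<mu> \<in> Dis n" "length \<mu> = max (length \<gamma>) (length \<delta>)"
    "\<And>\<epsilon>. \<epsilon> \<in> Dis n \<Longrightarrow> \<mu> \<succeq> \<epsilon> \<longleftrightarrow> \<gamma> \<succeq> \<epsilon> \<and> \<delta> \<succeq> \<epsilon>"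
    using \<nu> below by auto
qed

lemma Dis_join:
  assumes "n > 0" "\<gamma> \<in> Dis n" "\<delta> \<in> Dis n"
  defines "\<sigma> \<equiv> \<gamma> \<squnion>\<^bsub>Dis_poset n\<^esub> \<delta>"
  shows "\<sigma> \<in> Dis n" "length \<sigma> = min (length \<gamma>) (length \<delta>)"
    "\<And>\<epsilon>. \<epsilon> \<in> Dis n \<Longrightarrow> \<epsilon> \<succeq> \<sigma> \<longleftrightarrow> \<epsilon> \<succeq> \<gamma> \<and> \<epsilon> \<succeq> \<delta>"
proof -
  obtain \<rho> where \<rho>: "\<rho> \<in> Dis n" "\<rho> \<succeq> \<gamma>" "\<rho> \<succeq> \<delta>" "length \<rho> = min (length \<gamma>) (length \<delta>)"
    and least: "\<And>\<upsilon>. \<upsilon> \<in> Dis n \<Longrightarrow> \<upsilon> \<succeq> \<gamma> \<Longrightarrow> \<upsilon> \<succeq> \<delta> \<Longrightarrow> \<upsilon> \<succeq> \<rho>"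
    using ex_join assms by metis
  have "\<sigma> = \<rho>"
    unfolding \<sigma>_def using \<rho> least assms
    by (intro partial_order.join_eqI[OF partial_order_Dis]) (auto simp: Dis_poset_def)
  then show "\<sigma> \<in> Dis n" "length \<sigma> = min (length \<gamma>) (length \<delta>)"
    "\<And>\<epsilon>. \<epsilon> \<in> Dis n \<Longrightarrow> \<epsilon> \<succeq> \<sigma> \<longleftrightarrow> \<epsilon> \<succeq> \<gamma> \<and> \<epsilon> \<succeq> \<delta>"
    using \<rho> least majorizes_trans assms(2,3) by blast+
qed

section \<open>Meets and joins of blocks\<close>

lemma partial_order_add_hats:
  assumes "partial_order L" "eq L = (=)"
  shows "partial_order (add_hats L)"
proof -
  interpret partial_order L by fact
  show ?thesis
  proof
    fix x y z assume "x \<in> carrier (add_hats L)" "y \<in> carrier (add_hats L)" "z \<in> carrier (add_hats L)"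
      "le (add_hats L) x y" "le (add_hats L) y z"
    then show "le (add_hats L) x z"
      by (cases x; cases y; cases z) (auto simp: add_hats_def intro: le_trans)
  next
    fix x y assume "le (add_hats L) x y" "le (add_hats L) y x"
      "x \<in> carrier (add_hats L)" "y \<in> carrier (add_hats L)"
    then show "x .=\<^bsub>add_hats L\<^esub> y"
      by (cases x; cases y) (auto simp: add_hats_def intro: le_antisym)
  next
    fix x assume "x \<in> carrier (add_hats L)"
    then show "le (add_hats L) x x"
      by (cases x) (auto simp: add_hats_def)
  qed (auto simp: add_hats_def)
qed

lemma partial_order_S_Block_hat: "partial_order (S_Block_hat n)"
proof -
  have "partial_order (S_Block_poset n)"
  proof
    fix x y z
    assume "x \<in> carrier (S_Block_poset n)" "y \<in> carrier (S_Block_poset n)" "z \<in> carrier (S_Block_poset n)"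
      "x \<sqsubseteq>\<^bsub>S_Block_poset n\<^esub> y" "y \<sqsubseteq>\<^bsub>S_Block_poset n\<^esub> z"
    then show "x \<sqsubseteq>\<^bsub>S_Block_poset n\<^esub> z"
      using majorizes_trans[of "fst z" n "fst y" "fst x"] majorizes_trans[of "snd x" n "snd y" "snd z"]
      by (auto simp: S_Block_poset_def S_Block_def)
  next
    fix x y
    assume "x \<sqsubseteq>\<^bsub>S_Block_poset n\<^esub> y" "y \<sqsubseteq>\<^bsub>S_Block_poset n\<^esub> x"
      "x \<in> carrier (S_Block_poset n)" "y \<in> carrier (S_Block_poset n)"
    then show "x .=\<^bsub>S_Block_poset n\<^esub> y"
      using majorizes_antisym[of "fst x" n "fst y"] majorizes_antisym[of "snd x" n "snd y"]
      by (auto simp: S_Block_poset_def S_Block_def)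
  qed (auto simp: S_Block_poset_def majorizes_refl)
  then show ?thesis
    unfolding S_Block_hat_def by (rule partial_order_add_hats) (simp add: S_Block_poset_def)
qed

lemma carrier_S_Block_hat: "carrier (S_Block_hat n) = {Hat0, Hat1} \<union> Inner ` S_Block n"
  by (simp add: S_Block_hat_def add_hats_def S_Block_poset_def)

lemma le_S_Block_hat:
  "le (S_Block_hat n) = hat_le (\<lambda>(\<alpha>\<^sub>2, \<beta>\<^sub>2) (\<alpha>\<^sub>1, \<beta>\<^sub>1). \<alpha>\<^sub>1 \<succeq> \<alpha>\<^sub>2 \<and> \<beta>\<^sub>2 \<succeq> \<beta>\<^sub>1)"
  by (simp add: S_Block_hat_def add_hats_def S_Block_poset_def)

text \<open>Majorization already gives \<open>length \<beta> \<le> length \<alpha>\<close>, so the length condition is a single inequality.\<close>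
lemma S_Block_iff:
  "(\<alpha>, \<beta>) \<in> S_Block n \<longleftrightarrow> \<alpha> \<in> Dis n \<and> \<beta> \<in> Dis n \<and> \<beta> \<succeq> \<alpha> \<and> length \<alpha> \<le> length \<beta> + 1"
  using majorizes_length[of \<alpha> n \<beta>] by (auto simp: S_Block_def)

text \<open>
  A lower bound \<open>(\<alpha>, \<beta>)\<close> has at least as many parts in \<open>\<alpha>\<close> as the candidate, and at most as many
  in \<open>\<beta>\<close>. So if the lengths of the candidate are too far apart, those of every lower bound
  would be too, and only \<open>Hat0\<close> is left.
\<close>
lemma
  assumes n: "n > 0"
    and B1: "(\<alpha>\<^sub>1, \<beta>\<^sub>1) \<in> S_Block n" and B2: "(\<alpha>\<^sub>2, \<beta>\<^sub>2) \<in> S_Block n"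
  shows S_Block_meet_mem: "(\<alpha>\<^sub>1 \<sqinter>\<^bsub>Dis_poset n\<^esub> \<alpha>\<^sub>2, \<beta>\<^sub>1 \<squnion>\<^bsub>Dis_poset n\<^esub> \<beta>\<^sub>2) \<in> S_Block n \<longleftrightarrow>
      max (length \<alpha>\<^sub>1) (length \<alpha>\<^sub>2) \<le> min (length \<beta>\<^sub>1) (length \<beta>\<^sub>2) + 1"
    and S_Block_meet_eq: "Inner (\<alpha>\<^sub>1, \<beta>\<^sub>1) \<sqinter>\<^bsub>S_Block_hat n\<^esub> Inner (\<alpha>\<^sub>2, \<beta>\<^sub>2) =
    (if max (length \<alpha>\<^sub>1) (length \<alpha>\<^sub>2) \<le> min (length \<beta>\<^sub>1) (length \<beta>\<^sub>2) + 1
     then Inner (\<alpha>\<^sub>1 \<sqinter>\<^bsub>Dis_poset n\<^esub> \<alpha>\<^sub>2, \<beta>\<^sub>1 \<squnion>\<^bsub>Dis_poset n\<^esub> \<beta>\<^sub>2) else Hat0)"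
proof -
  let ?\<alpha> = "\<alpha>\<^sub>1 \<sqinter>\<^bsub>Dis_poset n\<^esub> \<alpha>\<^sub>2" and ?\<beta> = "\<beta>\<^sub>1 \<squnion>\<^bsub>Dis_poset n\<^esub> \<beta>\<^sub>2"
  from B1 B2 have D: "\<alpha>\<^sub>1 \<in> Dis n" "\<alpha>\<^sub>2 \<in> Dis n" "\<beta>\<^sub>1 \<in> Dis n" "\<beta>\<^sub>2 \<in> Dis n"
    and maj: "\<beta>\<^sub>1 \<succeq> \<alpha>\<^sub>1" "\<beta>\<^sub>2 \<succeq> \<alpha>\<^sub>2"
    by (auto simp: S_Block_iff)
  note \<alpha> = Dis_meet[OF D(1,2)] and \<beta> = Dis_join[OF n D(3,4)]
  have bounds: "\<alpha>\<^sub>1 \<succeq> ?\<alpha>" "\<alpha>\<^sub>2 \<succeq> ?\<alpha>" "?\<beta> \<succeq> \<beta>\<^sub>1" "?\<beta> \<succeq> \<beta>\<^sub>2"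
    using \<alpha>(3)[OF \<alpha>(1)] \<beta>(3)[OF \<beta>(1)] majorizes_refl by auto
  have "?\<beta> \<succeq> ?\<alpha>"
    using bounds maj majorizes_trans D \<alpha>(1) \<beta>(1) by metis
  then have block: "(?\<alpha>, ?\<beta>) \<in> S_Block n \<longleftrightarrow>
      max (length \<alpha>\<^sub>1) (length \<alpha>\<^sub>2) \<le> min (length \<beta>\<^sub>1) (length \<beta>\<^sub>2) + 1"
    using \<alpha> \<beta> by (simp add: S_Block_iff)
  have lower: "?\<alpha> \<succeq> \<alpha> \<and> \<beta> \<succeq> ?\<beta> \<and> (?\<alpha>, ?\<beta>) \<in> S_Block n"
    if "(\<alpha>, \<beta>) \<in> S_Block n" "\<alpha>\<^sub>1 \<succeq> \<alpha>" "\<alpha>\<^sub>2 \<succeq> \<alpha>" "\<beta> \<succeq> \<beta>\<^sub>1" "\<beta> \<succeq> \<beta>\<^sub>2" for \<alpha> \<beta>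
  proof -
    have d: "\<alpha> \<in> Dis n" "\<beta> \<in> Dis n" "length \<alpha> \<le> length \<beta> + 1" using that by (auto simp: S_Block_iff)
    have "length ?\<alpha> \<le> length \<alpha>" "length \<beta> \<le> length ?\<beta>"
      using majorizes_length d \<alpha> \<beta> that by blast+
    then have "max (length \<alpha>\<^sub>1) (length \<alpha>\<^sub>2) \<le> min (length \<beta>\<^sub>1) (length \<beta>\<^sub>2) + 1"
      using d \<alpha>(2) \<beta>(2) by linarith
    then show ?thesis using that d \<alpha>(3) \<beta>(3) block by simp
  qed
  show "(?\<alpha>, ?\<beta>) \<in> S_Block n \<longleftrightarrow>
      max (length \<alpha>\<^sub>1) (length \<alpha>\<^sub>2) \<le> min (length \<beta>\<^sub>1) (length \<beta>\<^sub>2) + 1"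
    by (rule block)
  show "Inner (\<alpha>\<^sub>1, \<beta>\<^sub>1) \<sqinter>\<^bsub>S_Block_hat n\<^esub> Inner (\<alpha>\<^sub>2, \<beta>\<^sub>2) =
    (if max (length \<alpha>\<^sub>1) (length \<alpha>\<^sub>2) \<le> min (length \<beta>\<^sub>1) (length \<beta>\<^sub>2) + 1
     then Inner (?\<alpha>, ?\<beta>) else Hat0)"
  proof (cases "(?\<alpha>, ?\<beta>) \<in> S_Block n")
    case True
    have "Inner (\<alpha>\<^sub>1, \<beta>\<^sub>1) \<sqinter>\<^bsub>S_Block_hat n\<^esub> Inner (\<alpha>\<^sub>2, \<beta>\<^sub>2) = Inner (?\<alpha>, ?\<beta>)"
      by (rule partial_order.meet_eqI[OF partial_order_S_Block_hat])
        (use True B1 B2 bounds lower in \<open>auto simp: carrier_S_Block_hat le_S_Block_hat\<close>)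
    with True block show ?thesis by simp
  next
    case False
    have "Inner (\<alpha>\<^sub>1, \<beta>\<^sub>1) \<sqinter>\<^bsub>S_Block_hat n\<^esub> Inner (\<alpha>\<^sub>2, \<beta>\<^sub>2) = Hat0"
      by (rule partial_order.meet_eqI[OF partial_order_S_Block_hat])
        (use False B1 B2 lower in \<open>auto simp: carrier_S_Block_hat le_S_Block_hat\<close>)
    with False block show ?thesis by simp
  qed
qed

text \<open>
  The length condition is automatic: \<open>min (length \<alpha>\<^sub>1) (length \<alpha>\<^sub>2) \<le> length \<alpha>\<^sub>1 \<le> length \<beta>\<^sub>1 + 1\<close>,
  which is at most \<open>max (length \<beta>\<^sub>1) (length \<beta>\<^sub>2) + 1\<close>. An upper bound \<open>(\<alpha>, \<beta>)\<close> forces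
  \<open>\<beta>\<^sub>1 \<sqinter> \<beta>\<^sub>2 \<succeq> \<beta> \<succeq> \<alpha> \<succeq> \<alpha>\<^sub>1 \<squnion> \<alpha>\<^sub>2\<close>, so it exists only if the candidate itself is a block.
\<close>
lemma
  assumes n: "n > 0"
    and B1: "(\<alpha>\<^sub>1, \<beta>\<^sub>1) \<in> S_Block n" and B2: "(\<alpha>\<^sub>2, \<beta>\<^sub>2) \<in> S_Block n"
  shows S_Block_join_mem: "(\<alpha>\<^sub>1 \<squnion>\<^bsub>Dis_poset n\<^esub> \<alpha>\<^sub>2, \<beta>\<^sub>1 \<sqinter>\<^bsub>Dis_poset n\<^esub> \<beta>\<^sub>2) \<in> S_Block n \<longleftrightarrow>
      \<beta>\<^sub>1 \<sqinter>\<^bsub>Dis_poset n\<^esub> \<beta>\<^sub>2 \<succeq> \<alpha>\<^sub>1 \<squnion>\<^bsub>Dis_poset n\<^esub> \<alpha>\<^sub>2"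
    and S_Block_join_eq: "Inner (\<alpha>\<^sub>1, \<beta>\<^sub>1) \<squnion>\<^bsub>S_Block_hat n\<^esub> Inner (\<alpha>\<^sub>2, \<beta>\<^sub>2) =
    (if \<beta>\<^sub>1 \<sqinter>\<^bsub>Dis_poset n\<^esub> \<beta>\<^sub>2 \<succeq> \<alpha>\<^sub>1 \<squnion>\<^bsub>Dis_poset n\<^esub> \<alpha>\<^sub>2
     then Inner (\<alpha>\<^sub>1 \<squnion>\<^bsub>Dis_poset n\<^esub> \<alpha>\<^sub>2, \<beta>\<^sub>1 \<sqinter>\<^bsub>Dis_poset n\<^esub> \<beta>\<^sub>2) else Hat1)"
proof -
  let ?\<alpha> = "\<alpha>\<^sub>1 \<squnion>\<^bsub>Dis_poset n\<^esub> \<alpha>\<^sub>2" and ?\<beta> = "\<beta>\<^sub>1 \<sqinter>\<^bsub>Dis_poset n\<^esub> \<beta>\<^sub>2"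
  from B1 B2 have D: "\<alpha>\<^sub>1 \<in> Dis n" "\<alpha>\<^sub>2 \<in> Dis n" "\<beta>\<^sub>1 \<in> Dis n" "\<beta>\<^sub>2 \<in> Dis n"
    and len: "length \<alpha>\<^sub>1 \<le> length \<beta>\<^sub>1 + 1"
    by (auto simp: S_Block_iff)
  note \<alpha> = Dis_join[OF n D(1,2)] and \<beta> = Dis_meet[OF D(3,4)]
  have bounds: "?\<alpha> \<succeq> \<alpha>\<^sub>1" "?\<alpha> \<succeq> \<alpha>\<^sub>2" "\<beta>\<^sub>1 \<succeq> ?\<beta>" "\<beta>\<^sub>2 \<succeq> ?\<beta>"
    using \<alpha>(3)[OF \<alpha>(1)] \<beta>(3)[OF \<beta>(1)] majorizes_refl by auto
  have block: "(?\<alpha>, ?\<beta>) \<in> S_Block n \<longleftrightarrow> ?\<beta> \<succeq> ?\<alpha>"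
    using \<alpha> \<beta> len by (auto simp: S_Block_iff)
  have upper: "\<alpha> \<succeq> ?\<alpha> \<and> ?\<beta> \<succeq> \<beta> \<and> (?\<alpha>, ?\<beta>) \<in> S_Block n"
    if "(\<alpha>, \<beta>) \<in> S_Block n" "\<alpha> \<succeq> \<alpha>\<^sub>1" "\<alpha> \<succeq> \<alpha>\<^sub>2" "\<beta>\<^sub>1 \<succeq> \<beta>" "\<beta>\<^sub>2 \<succeq> \<beta>" for \<alpha> \<beta>
  proof -
    have d: "\<alpha> \<in> Dis n" "\<beta> \<in> Dis n" "\<beta> \<succeq> \<alpha>" using that by (auto simp: S_Block_iff)
    then have "\<alpha> \<succeq> ?\<alpha>" "?\<beta> \<succeq> \<beta>" using \<alpha> \<beta> that by auto
    moreover then have "?\<beta> \<succeq> ?\<alpha>" using d \<alpha>(1) \<beta>(1) majorizes_trans by metis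
    ultimately show ?thesis using block by simp
  qed
  show "(?\<alpha>, ?\<beta>) \<in> S_Block n \<longleftrightarrow> ?\<beta> \<succeq> ?\<alpha>"
    by (rule block)
  show "Inner (\<alpha>\<^sub>1, \<beta>\<^sub>1) \<squnion>\<^bsub>S_Block_hat n\<^esub> Inner (\<alpha>\<^sub>2, \<beta>\<^sub>2) =
    (if ?\<beta> \<succeq> ?\<alpha> then Inner (?\<alpha>, ?\<beta>) else Hat1)"
  proof (cases "?\<beta> \<succeq> ?\<alpha>")
    case True
    have "Inner (\<alpha>\<^sub>1, \<beta>\<^sub>1) \<squnion>\<^bsub>S_Block_hat n\<^esub> Inner (\<alpha>\<^sub>2, \<beta>\<^sub>2) = Inner (?\<alpha>, ?\<beta>)"
      by (rule partial_order.join_eqI[OF partial_order_S_Block_hat])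
        (use True block B1 B2 bounds upper in \<open>auto simp: carrier_S_Block_hat le_S_Block_hat\<close>)
    with True show ?thesis by simp
  next
    case False
    have "Inner (\<alpha>\<^sub>1, \<beta>\<^sub>1) \<squnion>\<^bsub>S_Block_hat n\<^esub> Inner (\<alpha>\<^sub>2, \<beta>\<^sub>2) = Hat1"
      by (rule partial_order.join_eqI[OF partial_order_S_Block_hat])
        (use False block B1 B2 upper in \<open>auto simp: carrier_S_Block_hat le_S_Block_hat\<close>)
    with False show ?thesis by simp
  qed
qed

theorem theorem5p2:
  fixes n k j :: nat
    and \<alpha>\<^sub>1 \<beta>\<^sub>1 \<alpha>\<^sub>2 \<beta>\<^sub>2 :: "nat list"
    and M J :: "block hat"
  assumes "n > 0"
    and "(\<alpha>\<^sub>1, \<beta>\<^sub>1) \<in> S_Block n"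
    and "(\<alpha>\<^sub>2, \<beta>\<^sub>2) \<in> S_Block n"
    and "k = length \<alpha>\<^sub>1"
    and "j = length \<alpha>\<^sub>2"
    and "M = Inner (\<alpha>\<^sub>1, \<beta>\<^sub>1) \<sqinter>\<^bsub>S_Block_hat n\<^esub> Inner (\<alpha>\<^sub>2, \<beta>\<^sub>2)"
    and "J = Inner (\<alpha>\<^sub>1, \<beta>\<^sub>1) \<squnion>\<^bsub>S_Block_hat n\<^esub> Inner (\<alpha>\<^sub>2, \<beta>\<^sub>2)"
  shows
    "((\<alpha>\<^sub>1, \<beta>\<^sub>1) \<in> A n k \<and> (\<alpha>\<^sub>2, \<beta>\<^sub>2) \<in> A n k \<longrightarrow>
        M \<in> Inner ` A n k \<and> (J \<in> Inner ` A n k \<or> J = Hat1) \<and>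
        (J = Hat1 \<longleftrightarrow> \<not> (\<beta>\<^sub>1 \<sqinter>\<^bsub>Dis_poset n\<^esub> \<beta>\<^sub>2) \<succeq> (\<alpha>\<^sub>1 \<squnion>\<^bsub>Dis_poset n\<^esub> \<alpha>\<^sub>2)))
     \<and> ((\<alpha>\<^sub>1, \<beta>\<^sub>1) \<in> A' n k (k - 1) \<and> (\<alpha>\<^sub>2, \<beta>\<^sub>2) \<in> A' n k (k - 1) \<longrightarrow>
        M \<in> Inner ` A' n k (k - 1) \<and> (J \<in> Inner ` A' n k (k - 1) \<or> J = Hat1) \<and>
        (J = Hat1 \<longleftrightarrow> \<not> (\<beta>\<^sub>1 \<sqinter>\<^bsub>Dis_poset n\<^esub> \<beta>\<^sub>2) \<succeq> (\<alpha>\<^sub>1 \<squnion>\<^bsub>Dis_poset n\<^esub> \<alpha>\<^sub>2)))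
     \<and> (k > j + 1 \<and> (\<alpha>\<^sub>1, \<beta>\<^sub>1) \<in> A n k \<and> (\<alpha>\<^sub>2, \<beta>\<^sub>2) \<in> A n j \<longrightarrow>
        M = Hat0 \<and> J = Hat1 \<and>
        (J = Hat1 \<longleftrightarrow> \<not> (\<beta>\<^sub>1 \<sqinter>\<^bsub>Dis_poset n\<^esub> \<beta>\<^sub>2) \<succeq> (\<alpha>\<^sub>1 \<squnion>\<^bsub>Dis_poset n\<^esub> \<alpha>\<^sub>2)))
     \<and> (k = j + 1 \<and> (\<alpha>\<^sub>1, \<beta>\<^sub>1) \<in> A n k \<and> (\<alpha>\<^sub>2, \<beta>\<^sub>2) \<in> A n (k - 1) \<longrightarrow>
        M \<in> Inner ` A' n k (k - 1) \<and> J = Hat1 \<and>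
        (J = Hat1 \<longleftrightarrow> \<not> (\<beta>\<^sub>1 \<sqinter>\<^bsub>Dis_poset n\<^esub> \<beta>\<^sub>2) \<succeq> (\<alpha>\<^sub>1 \<squnion>\<^bsub>Dis_poset n\<^esub> \<alpha>\<^sub>2)))
     \<and> (k > j + 1 \<and> (\<alpha>\<^sub>1, \<beta>\<^sub>1) \<in> A' n k (k - 1) \<and> (\<alpha>\<^sub>2, \<beta>\<^sub>2) \<in> A' n j (j - 1) \<longrightarrow>
        M = Hat0 \<and> J = Hat1 \<and>
        (J = Hat1 \<longleftrightarrow> \<not> (\<beta>\<^sub>1 \<sqinter>\<^bsub>Dis_poset n\<^esub> \<beta>\<^sub>2) \<succeq> (\<alpha>\<^sub>1 \<squnion>\<^bsub>Dis_poset n\<^esub> \<alpha>\<^sub>2)))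
     \<and> (k = j + 1 \<and> (\<alpha>\<^sub>1, \<beta>\<^sub>1) \<in> A' n k (k - 1) \<and> (\<alpha>\<^sub>2, \<beta>\<^sub>2) \<in> A' n (k - 1) (k - 2) \<longrightarrow>
        M = Hat0 \<and> (J \<in> Inner ` A n (k - 1) \<or> J = Hat1) \<and>
        (J = Hat1 \<longleftrightarrow> \<not> (\<beta>\<^sub>1 \<sqinter>\<^bsub>Dis_poset n\<^esub> \<beta>\<^sub>2) \<succeq> (\<alpha>\<^sub>1 \<squnion>\<^bsub>Dis_poset n\<^esub> \<alpha>\<^sub>2)))
     \<and> (k \<in> {j, j - 1} \<and> (\<alpha>\<^sub>1, \<beta>\<^sub>1) \<in> A n k \<and> (\<alpha>\<^sub>2, \<beta>\<^sub>2) \<in> A' n j (j - 1) \<longrightarrow>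
        M \<in> Inner ` A' n j (j - 1) \<and> (J \<in> Inner ` A n k \<or> J = Hat1) \<and>
        (J = Hat1 \<longleftrightarrow> \<not> (\<beta>\<^sub>1 \<sqinter>\<^bsub>Dis_poset n\<^esub> \<beta>\<^sub>2) \<succeq> (\<alpha>\<^sub>1 \<squnion>\<^bsub>Dis_poset n\<^esub> \<alpha>\<^sub>2)))
     \<and> (k \<notin> {j, j - 1} \<and> (\<alpha>\<^sub>1, \<beta>\<^sub>1) \<in> A n k \<and> (\<alpha>\<^sub>2, \<beta>\<^sub>2) \<in> A' n j (j - 1) \<longrightarrow>
        M = Hat0 \<and> J = Hat1 \<and>
        (J = Hat1 \<longleftrightarrow> \<not> (\<beta>\<^sub>1 \<sqinter>\<^bsub>Dis_poset n\<^esub> \<beta>\<^sub>2) \<succeq> (\<alpha>\<^sub>1 \<squnion>\<^bsub>Dis_poset n\<^esub> \<alpha>\<^sub>2)))"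
proof -
  let ?\<alpha>m = "\<alpha>\<^sub>1 \<sqinter>\<^bsub>Dis_poset n\<^esub> \<alpha>\<^sub>2" and ?\<beta>j = "\<beta>\<^sub>1 \<squnion>\<^bsub>Dis_poset n\<^esub> \<beta>\<^sub>2"
  let ?\<alpha>j = "\<alpha>\<^sub>1 \<squnion>\<^bsub>Dis_poset n\<^esub> \<alpha>\<^sub>2" and ?\<beta>m = "\<beta>\<^sub>1 \<sqinter>\<^bsub>Dis_poset n\<^esub> \<beta>\<^sub>2"
  have D: "\<alpha>\<^sub>1 \<in> Dis n" "\<alpha>\<^sub>2 \<in> Dis n" "\<beta>\<^sub>1 \<in> Dis n" "\<beta>\<^sub>2 \<in> Dis n"
    using assms by (auto simp: S_Block_iff)
  define k' j' where kj': "k' = length \<beta>\<^sub>1" "j' = length \<beta>\<^sub>2"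
  \<comment> \<open>Positivity rules out the boundary cases where \<open>k - 1\<close> or \<open>k - 2\<close> is truncated or zero.\<close>
  have pos: "0 < k" "0 < j" "0 < k'" "0 < j'"
    using D \<open>n > 0\<close> assms(4,5) by (simp_all add: Dis_nonempty kj')
  have A'_iff: "(\<alpha>, \<beta>) \<in> A' n l l' \<longleftrightarrow> (\<alpha>, \<beta>) \<in> S_Block n \<and> length \<alpha> = l \<and> length \<beta> = l'"
    for \<alpha> \<beta> l l'
    by (auto simp: A'_def Dis_k_def S_Block_def)
  have len: "length ?\<alpha>m = max k j" "length ?\<beta>j = min k' j'"
    "length ?\<alpha>j = min k j" "length ?\<beta>m = max k' j'"
    using Dis_meet(2) Dis_join(2) D \<open>n > 0\<close> assms(4,5) kj' by auto
  have M: "M = (if max k j \<le> min k' j' + 1 then Inner (?\<alpha>m, ?\<beta>j) else Hat0)"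
    using S_Block_meet_eq[OF assms(1-3)] assms(4-6) kj' by simp
  have J: "J = (if ?\<beta>m \<succeq> ?\<alpha>j then Inner (?\<alpha>j, ?\<beta>m) else Hat1)"
    using S_Block_join_eq[OF assms(1-3)] assms(7) by simp
  have M_in: "M \<in> Inner ` A' n a b" if "max k j = a" "min k' j' = b" "a \<le> b + 1" for a b
  proof -
    have "(?\<alpha>m, ?\<beta>j) \<in> A' n a b"
      using that len
      by (simp add: A'_iff S_Block_meet_mem[OF assms(1-3)] flip: assms(4,5) kj' del: max.bounded_iff)
    then show ?thesis using M that by simp
  qed
  have M_Hat0: "M = Hat0" if "min k' j' + 1 < max k j"
    unfolding M using that by (intro if_not_P) linarith
  have J_Hat1_iff: "J = Hat1 \<longleftrightarrow> \<not> ?\<beta>m \<succeq> ?\<alpha>j"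
    using J by simp
  have J_in: "J \<in> Inner ` A' n a b \<or> J = Hat1" if "min k j = a" "max k' j' = b" for a b
    using S_Block_join_mem[OF assms(1-3)] that J len by (simp add: A'_iff)
  \<comment> \<open>The candidate would violate the rule that the larger partition has no more parts.\<close>
  have J_Hat1: "J = Hat1" if "min k j < max k' j'"
    using that majorizes_length[of ?\<alpha>j n ?\<beta>m] Dis_join(1)[OF \<open>n > 0\<close> D(1,2)] Dis_meet(1)[OF D(3,4)]
      J len by auto
  have blocks: "(\<alpha>\<^sub>1, \<beta>\<^sub>1) \<in> A' n a b \<longleftrightarrow> k = a \<and> k' = b"
    "(\<alpha>\<^sub>2, \<beta>\<^sub>2) \<in> A' n a b \<longleftrightarrow> j = a \<and> j' = b" for a b
    using assms(2-5) kj' by (auto simp: A'_iff)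
  have A_eq: "A n a = A' n a a" for a
    by (simp add: A_def A'_def)
  show ?thesis
    unfolding A_eq blocks J_Hat1_iff[symmetric]
    by (intro conjI impI M_in M_Hat0 J_in J_Hat1 refl; elim conjE; use pos in auto)
qed

end
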